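(* Let $(M, M')$ be a matroid perspective on a finite ground set $E$ with a total ordering $<$ on $E$. Then there is a bijection $$\{B\subseteq E : B \text{ is independent in } M \text{ and spanning in } M'\} \longleftrightarrow \mathcal{D}(M, M', <),$$ given by $$f(B) := (B\setminus \mathrm{Int}_{M'}(B)) \cup \mathrm{Ext}_M(B),$$ with inverse mapping $$g(X) := (X \setminus B_{\min}((M|X)^* )) \cup B_{\min}(M'/X).$$
   Context: Matroids are on a finite ground set $E$ with a fixed total ordering $<$; $N^*$ denotes the dual of a matroid $N$; an $N$-circuit is a circuit of $N$. $M|X$ is the restriction of $M$ to $X$ (ground set $X$), and $M'/X$ is the contraction of $M'$ by $X$ (ground set $E\setminus X$). $X\cup e$ means $X\cup\{e\}$. Matroid perspective: a pair $(M,M')$ of matroids on a common ground set $E$ is a matroid perspective if every circuit of $M$ is a union of circuits of $M'$. Activities: for a matroid $N$ on $E$ and an arbitrary subset $X\subseteq E$, $$\mathrm{Int}_N(X) := \{e\in X : (E\setminus X)\cup e \text{ contains an } N^*\text{-circuit with } e \text{ as its minimal element}\},$$ $$\mathrm{Ext}_N(X) := \{e\in E\setminus X : X\cup e \text{ contains an } N\text{-circuit with } e \text{ as its minimal element}\}.$$ Compatibility: a set $X\subseteq E$ is $(N,<)$-compatible if there is no $N$-circuit $C$ with $X\cap C=\{\min(C)\}$. The set $\mathcal{D}(M,M',<)$ is $$\mathcal{D}(M, M', <) := \{X\subseteq E : X \text{ is } ((M')^*,<)\text{-compatible and } E\setminus X \text{ is } (M,<)\text{-compatible}\}.$$ Minimal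 basis: the total order $<$ on the ground set of a matroid $N$ induces a total lexicographic order on the bases of $N$; $B_{\min}(N)$ denotes the minimal basis of $N$ under this ordering. For $(M|X)^*$ and $M'/X$ the ground sets $X$ and $E\setminus X$ carry the restriction of $<$. *)

theory Defs
  imports Main
begin

record 'a pre_matroid =
  ground :: "'a set"
  indeps :: "'a set set"

definition matroid :: "'a pre_matroid \<Rightarrow> bool" where
  "matroid N \<longleftrightarrow>
     finite (ground N) \<and>
     indeps N \<subseteq> Pow (ground N) \<and>
     {} \<in> indeps N \<and>
     (\<forall>I J. I \<in> indeps N \<longrightarrow> J \<subseteq> I \<longrightarrow> J \<in> indeps N) \<and>
     (\<forall>I J. I \<in> indeps N \<longrightarrow> J \<in> indeps N \<longrightarrow> card I < card J \<longrightarrow>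
        (\<exists>e\<in>J - I. insert e I \<in> indeps N))"

definition basis :: "'a pre_matroid \<Rightarrow> 'a set \<Rightarrow> bool" where
  "basis N B \<longleftrightarrow> B \<in> indeps N \<and> (\<forall>I\<in>indeps N. B \<subseteq> I \<longrightarrow> I = B)"

definition circuit :: "'a pre_matroid \<Rightarrow> 'a set \<Rightarrow> bool" where
  "circuit N C \<longleftrightarrow> C \<subseteq> ground N \<and> C \<notin> indeps N \<and> (\<forall>D. D \<subset> C \<longrightarrow> D \<in> indeps N)"

definition spanning :: "'a pre_matroid \<Rightarrow> 'a set \<Rightarrow> bool" where
  "spanning N S \<longleftrightarrow> S \<subseteq> ground N \<and> (\<exists>B. basis N B \<and> B \<subseteq> S)"

(* The bases of the dual are the complements of the bases of N. *)
definition dual :: "'a pre_matroid \<Rightarrow> 'a pre_matroid" where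
  "dual N = \<lparr>ground = ground N, indeps = {I. \<exists>B. basis N B \<and> I \<subseteq> ground N - B}\<rparr>"

(* Only meaningful for X contained in the ground set; likewise contract. *)
definition restrict :: "'a pre_matroid \<Rightarrow> 'a set \<Rightarrow> 'a pre_matroid" where
  "restrict N X = \<lparr>ground = X, indeps = {I \<in> indeps N. I \<subseteq> X}\<rparr>"

(* N / X is the dual of the deletion of X from the dual of N. *)
definition contract :: "'a pre_matroid \<Rightarrow> 'a set \<Rightarrow> 'a pre_matroid" where
  "contract N X = dual (restrict (dual N) (ground N - X))"

definition matroid_perspective :: "'a pre_matroid \<Rightarrow> 'a pre_matroid \<Rightarrow> bool" where
  "matroid_perspective M M' \<longleftrightarrow>
     matroid M \<and> matroid M' \<and> ground M = ground M' \<and>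
     (\<forall>C. circuit M C \<longrightarrow> (\<exists>\<C>. (\<forall>D\<in>\<C>. circuit M' D) \<and> C = \<Union>\<C>))"

(* The total order on the ground set is the one of the element type. Circuits of a matroid are
   finite and nonempty, so Min is well defined on them. *)

definition int_act :: "('a::linorder) pre_matroid \<Rightarrow> 'a set \<Rightarrow> 'a set" where
  "int_act N X = {e \<in> X. \<exists>C. circuit (dual N) C \<and> C \<subseteq> insert e (ground N - X) \<and> Min C = e}"

definition ext_act :: "('a::linorder) pre_matroid \<Rightarrow> 'a set \<Rightarrow> 'a set" where
  "ext_act N X = {e \<in> ground N - X. \<exists>C. circuit N C \<and> C \<subseteq> insert e X \<and> Min C = e}"

definition compatible :: "('a::linorder) pre_matroid \<Rightarrow> 'a set \<Rightarrow> bool" where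
  "compatible N X \<longleftrightarrow> X \<subseteq> ground N \<and> \<not> (\<exists>C. circuit N C \<and> X \<inter> C = {Min C})"

definition D_set :: "('a::linorder) pre_matroid \<Rightarrow> 'a pre_matroid \<Rightarrow> 'a set set" where
  "D_set M M' = {X. X \<subseteq> ground M \<and> compatible (dual M') X \<and> compatible M (ground M - X)}"

(* Finite sets are compared lexicographically through their increasing enumerations. *)
definition lex_less :: "('a::linorder) set \<Rightarrow> 'a set \<Rightarrow> bool" where
  "lex_less A B \<longleftrightarrow> (sorted_list_of_set A, sorted_list_of_set B) \<in> lexord {(x, y). x < y}"

definition B_min :: "('a::linorder) pre_matroid \<Rightarrow> 'a set" where
  "B_min N = (THE B. basis N B \<and> (\<forall>B'. basis N B' \<longrightarrow> B' \<noteq> B \<longrightarrow> lex_less B B'))"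

definition indep_spanning :: "'a pre_matroid \<Rightarrow> 'a pre_matroid \<Rightarrow> 'a set set" where
  "indep_spanning M M' = {B. B \<subseteq> ground M \<and> B \<in> indeps M \<and> spanning M' B}"

definition f_map :: "('a::linorder) pre_matroid \<Rightarrow> 'a pre_matroid \<Rightarrow> 'a set \<Rightarrow> 'a set" where
  "f_map M M' B = (B - int_act M' B) \<union> ext_act M B"

definition g_map :: "('a::linorder) pre_matroid \<Rightarrow> 'a pre_matroid \<Rightarrow> 'a set \<Rightarrow> 'a set" where
  "g_map M M' X = (X - B_min (dual (restrict M X))) \<union> B_min (contract M' X)"

end

theory Submission imports Defs begin

text \<open>
  Let \<open>N\<close> be the dual of \<open>M'\<close>. A perspective enters only through orthogonality: a circuit of \<open>M\<close>
  and a circuit of \<open>N\<close> never meet in exactly one element. This condition, and the maps \<open>f\<close> and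
  \<open>g\<close>, are invariant under exchanging \<open>M\<close> with \<open>N\<close> and every set with its complement. The minimal
  basis of the dual of \<open>N|X\<close> consists of the minima of the circuits of \<open>N\<close> inside \<open>X\<close>, so \<open>g\<close>, like
  \<open>f\<close>, is described by minima of circuits, and \<open>f\<close> and \<open>g\<close> are mutually inverse as soon as the
  elements added by one are those removed by the other. Each such claim is obtained by playing
  orthogonality against an extremal element, with Minty's painting lemma supplying the cocircuits.
\<close>

section \<open>Matroids and their duals\<close>

lemma matroid_finite_ground: "matroid N \<Longrightarrow> finite (ground N)"
  and matroid_indep_subset_ground: "matroid N \<Longrightarrow> I \<in> indeps N \<Longrightarrow> I \<subseteq> ground N"
  and matroid_empty_indep: "matroid N \<Longrightarrow> {} \<in> indeps N"
  and matroid_indep_subset: "matroid N \<Longrightarrow> I \<in> indeps N \<Longrightarrow> J \<subseteq> I \<Longrightarrow> J \<in> indeps N"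
  and matroid_augment: "matroid N \<Longrightarrow> I \<in> indeps N \<Longrightarrow> J \<in> indeps N \<Longrightarrow> card I < card J \<Longrightarrow>
    \<exists>e\<in>J - I. insert e I \<in> indeps N"
  unfolding matroid_def by blast+

lemma matroid_indep_finite: "matroid N \<Longrightarrow> I \<in> indeps N \<Longrightarrow> finite I"
  using matroid_finite_ground matroid_indep_subset_ground finite_subset by metis

lemma basis_indep: "basis N B \<Longrightarrow> B \<in> indeps N"
  and basis_maximal: "basis N B \<Longrightarrow> I \<in> indeps N \<Longrightarrow> B \<subseteq> I \<Longrightarrow> I = B"
  unfolding basis_def by simp_all

lemma basis_subset_ground: "matroid N \<Longrightarrow> basis N B \<Longrightarrow> B \<subseteq> ground N"
  using matroid_indep_subset_ground basis_indep by metis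

lemma maximal_indep_between:
  assumes "matroid N" "I \<in> indeps N" "I \<subseteq> S"
  obtains K where "K \<in> indeps N" "I \<subseteq> K" "K \<subseteq> S"
    "\<And>e. e \<in> S \<Longrightarrow> insert e K \<in> indeps N \<Longrightarrow> e \<in> K"
proof -
  let ?F = "{K \<in> indeps N. I \<subseteq> K \<and> K \<subseteq> S}"
  have "finite ?F"
    using matroid_finite_ground[OF assms(1)] matroid_indep_subset_ground[OF assms(1)]
    by (intro finite_subset[of ?F "Pow (ground N)"]) auto
  moreover have "I \<in> ?F"
    using assms by simp
  ultimately have "\<exists>K\<in>?F. I \<subseteq> K \<and> (\<forall>L\<in>?F. K \<subseteq> L \<longrightarrow> K = L)"
    by (rule finite_has_maximal2)
  then obtain K where K: "K \<in> ?F" and max: "\<forall>L\<in>?F. K \<subseteq> L \<longrightarrow> K = L"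
    by blast
  show thesis
  proof (rule that)
    fix e assume "e \<in> S" "insert e K \<in> indeps N"
    then show "e \<in> K"
      using bspec[OF max, of "insert e K"] K by blast
  qed (use K in blast)+
qed

lemma indep_card_le_basis:
  assumes "matroid N" "basis N B" "I \<in> indeps N"
  shows "card I \<le> card B"
proof (rule ccontr)
  assume "\<not> ?thesis"
  then obtain e where "e \<in> I - B" "insert e B \<in> indeps N"
    using matroid_augment[OF assms(1), of B I] assms unfolding basis_def by force
  then show False
    using assms(2) unfolding basis_def by blast
qed

lemma card_bases_eq: "matroid N \<Longrightarrow> basis N B \<Longrightarrow> basis N B' \<Longrightarrow> card B = card B'"
  using indep_card_le_basis unfolding basis_def by (meson le_antisym)

lemma indep_basisI:
  assumes "matroid N" "basis N B" "I \<in> indeps N" "card B \<le> card I"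
  shows "basis N I"
  unfolding basis_def
proof (intro conjI ballI impI)
  fix J assume J: "J \<in> indeps N" "I \<subseteq> J"
  then have "card J \<le> card I"
    using indep_card_le_basis assms order_trans by blast
  then show "J = I"
    using J card_seteq matroid_indep_finite[OF assms(1)] by metis
qed (rule assms(3))

text \<open>The bound on \<open>B'\<close> is the point: it controls where new elements come from. A
  maximal independent set between \<open>I\<close> and \<open>I \<union> B\<close> is no smaller
  than \<open>B\<close>, since augmentation from \<open>B\<close> would enlarge it.\<close>

lemma extend_to_basis:
  assumes "matroid N" "I \<in> indeps N" "basis N B"
  obtains B' where "basis N B'" "I \<subseteq> B'" "B' \<subseteq> I \<union> B"
proof -
  obtain K where K: "K \<in> indeps N" "I \<subseteq> K" "K \<subseteq> I \<union> B"
    "\<And>e. e \<in> I \<union> B \<Longrightarrow> insert e K \<in> indeps N \<Longrightarrow> e \<in> K"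
    using maximal_indep_between[OF assms(1,2), of "I \<union> B"] by blast
  have "card B \<le> card K"
    using matroid_augment[OF assms(1) K(1) basis_indep[OF assms(3)]] K(4) by force
  then show thesis
    using that K indep_basisI assms by blast
qed

lemma basis_exists:
  assumes "matroid N"
  obtains B where "basis N B"
proof -
  obtain B where B: "B \<in> indeps N" "\<And>e. insert e B \<in> indeps N \<Longrightarrow> e \<in> B"
    using maximal_indep_between[OF assms matroid_empty_indep[OF assms], of UNIV] by auto
  have "basis N B"
    unfolding basis_def
  proof (intro conjI ballI impI)
    fix I assume I: "I \<in> indeps N" "B \<subseteq> I"
    have "e \<in> B" if "e \<in> I" for e
      using B(2)[of e] matroid_indep_subset[OF assms I(1), of "insert e B"] I(2) that by blast
    with I show "I = B" by blast
  qed (rule B(1))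
  then show thesis by (rule that)
qed

section \<open>Dual matroids and restrictions\<close>

lemma ground_dual [simp]: "ground (dual N) = ground N"
  by (simp add: dual_def)

lemma dual_indep_iff: "I \<in> indeps (dual N) \<longleftrightarrow> I \<subseteq> ground N \<and> (\<exists>B. basis N B \<and> I \<inter> B = {})"
  unfolding dual_def by auto

lemma dual_indepI:
  "basis N B \<Longrightarrow> I \<subseteq> ground N \<Longrightarrow> I \<inter> B = {} \<Longrightarrow> I \<in> indeps (dual N)"
  by (auto simp: dual_indep_iff)

lemma dual_indepE:
  assumes "I \<in> indeps (dual N)"
  obtains B where "basis N B" "I \<inter> B = {}" "I \<subseteq> ground N"
  using assms by (auto simp: dual_indep_iff)

text \<open>This puts the domain of \<open>f\<close> into a form that is symmetric under
  complementation.\<close>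

lemma spanning_iff_complement_dual_indep:
  assumes "S \<subseteq> ground N" "matroid N"
  shows "spanning N S \<longleftrightarrow> ground N - S \<in> indeps (dual N)"
proof -
  have "B \<subseteq> S \<longleftrightarrow> (ground N - S) \<inter> B = {}" if "basis N B" for B
    using basis_subset_ground[OF assms(2) that] by blast
  then show ?thesis
    unfolding spanning_def dual_indep_iff using assms(1) by auto
qed

text \<open>Extending \<open>B - I\<close> by elements of \<open>A\<close> yields a basis
  \<open>B'\<close> that avoids \<open>I\<close>, so any element of \<open>J - I\<close> outside
  \<open>B'\<close> can be added to \<open>I\<close>. If there were none, \<open>B'\<close> would
  contain the disjoint sets \<open>J - I\<close> and \<open>B - I\<close>, too many elements for a
  basis.\<close>

lemma dual_augment:
  assumes N: "matroid N" and I: "I \<in> indeps (dual N)" and J: "J \<in> indeps (dual N)"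
    and less: "card I < card J"
  shows "\<exists>e\<in>J - I. insert e I \<in> indeps (dual N)"
proof -
  obtain A where A: "basis N A" "I \<inter> A = {}" and Ig: "I \<subseteq> ground N"
    using dual_indepE[OF I] .
  obtain B where B: "basis N B" "J \<inter> B = {}" and Jg: "J \<subseteq> ground N"
    using dual_indepE[OF J] .
  have fin: "finite I" "finite J" "finite B"
    using finite_subset[OF Ig] finite_subset[OF Jg] finite_subset[OF basis_subset_ground[OF N B(1)]]
      matroid_finite_ground[OF N] by simp_all
  have "B - I \<in> indeps N"
    using matroid_indep_subset[OF N basis_indep[OF B(1)]] by simp
  then obtain B' where B': "basis N B'" "B - I \<subseteq> B'" "B' \<subseteq> (B - I) \<union> A"
    using extend_to_basis[OF N _ A(1)] by blast
  have "\<not> J - I \<subseteq> B'"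
  proof
    assume "J - I \<subseteq> B'"
    then have "(J - I) \<union> (B - I) \<subseteq> B'"
      using B' by blast
    moreover have "finite B'"
      using matroid_indep_finite[OF N basis_indep[OF B'(1)]] .
    ultimately have "card ((J - I) \<union> (B - I)) \<le> card B"
      using card_mono card_bases_eq[OF N B(1) B'(1)] by metis
    moreover have "card ((J - I) \<union> (B - I)) = card (J - I) + card (B - I)"
      using B(2) fin by (intro card_Un_disjoint) auto
    moreover have "card B = card (B - I) + card (B \<inter> I)"
      using card_Int_Diff[OF fin(3), of I] by simp
    \<comment> \<open>\<open>B\<close> avoids \<open>J\<close>, so removing \<open>I\<close> from
      \<open>B\<close> costs at most \<open>I - J\<close>, which is smaller than
      \<open>J - I\<close>.\<close>
    moreover have "card (B \<inter> I) \<le> card (I - J)"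
      using fin B(2) by (intro card_mono) auto
    moreover have "card (I - J) < card (J - I)"
      using less fin card_less_sym_Diff by blast
    ultimately show False by linarith
  qed
  then obtain e where "e \<in> J - I" "e \<notin> B'" by blast
  moreover have "insert e I \<inter> B' = {}"
    using B'(3) A(2) \<open>e \<notin> B'\<close> by blast
  moreover have "insert e I \<subseteq> ground N"
    using Ig Jg \<open>e \<in> J - I\<close> by blast
  ultimately show ?thesis
    using dual_indepI[OF B'(1)] by blast
qed

lemma matroid_dual:
  assumes "matroid N"
  shows "matroid (dual N)"
  unfolding matroid_def
proof (intro conjI allI impI)
  show "finite (ground (dual N))"
    using assms matroid_finite_ground by simp
  show "indeps (dual N) \<subseteq> Pow (ground (dual N))"
    by (auto simp: dual_indep_iff)
  show "{} \<in> indeps (dual N)"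
    using basis_exists[OF assms] by (auto simp: dual_indep_iff)
next
  fix I J assume "I \<in> indeps (dual N)" "J \<subseteq> I"
  then show "J \<in> indeps (dual N)"
    unfolding dual_indep_iff by blast
qed (rule dual_augment[OF assms])

lemma matroid_restrict:
  assumes "matroid N" "X \<subseteq> ground N"
  shows "matroid (restrict N X)"
  unfolding matroid_def
proof (intro conjI allI impI)
  show "finite (ground (restrict N X))"
    using finite_subset[OF assms(2) matroid_finite_ground[OF assms(1)]] by (simp add: restrict_def)
  fix I J assume "I \<in> indeps (restrict N X)" "J \<in> indeps (restrict N X)" "card I < card J"
  then show "\<exists>e\<in>J - I. insert e I \<in> indeps (restrict N X)"
    using matroid_augment[OF assms(1), of I J] unfolding restrict_def by auto
qed (use matroid_empty_indep[OF assms(1)] matroid_indep_subset[OF assms(1)] in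
    \<open>auto simp: restrict_def\<close>)

lemma dual_basisI:
  assumes "matroid N" "basis N B"
  shows "basis (dual N) (ground N - B)"
  unfolding basis_def
proof (intro conjI ballI impI)
  show "ground N - B \<in> indeps (dual N)"
    by (rule dual_indepI[OF assms(2)]) auto
  fix I assume I: "I \<in> indeps (dual N)" "ground N - B \<subseteq> I"
  then obtain A where A: "basis N A" "I \<inter> A = {}" and "I \<subseteq> ground N"
    using dual_indepE by metis
  then have "A \<subseteq> B"
    using I(2) basis_subset_ground[OF assms(1) A(1)] by blast
  then have "B = A"
    by (rule basis_maximal[OF A(1) basis_indep[OF assms(2)]])
  then show "I = ground N - B"
    using A(2) I(2) \<open>I \<subseteq> ground N\<close> by blast
qed

lemma dual_basis_complement:
  assumes "matroid N" "basis (dual N) B"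
  shows "basis N (ground N - B)"
proof -
  obtain A where A: "basis N A" "B \<inter> A = {}" and "B \<subseteq> ground N"
    using dual_indepE[OF basis_indep[OF assms(2)]] .
  then have "B \<subseteq> ground N - A" by blast
  then have "ground N - A = B"
    by (rule basis_maximal[OF assms(2) basis_indep[OF dual_basisI[OF assms(1) A(1)]]])
  then have "ground N - B = A"
    using basis_subset_ground[OF assms(1) A(1)] by blast
  then show ?thesis
    using A(1) by simp
qed

section \<open>Circuits, orthogonality and painting\<close>

lemma circuit_subset_ground: "circuit N C \<Longrightarrow> C \<subseteq> ground N"
  unfolding circuit_def by blast

lemma circuit_dependent: "circuit N C \<Longrightarrow> C \<notin> indeps N"
  and circuit_psubset_indep: "circuit N C \<Longrightarrow> D \<subset> C \<Longrightarrow> D \<in> indeps N"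
  unfolding circuit_def by simp_all

lemma circuit_finite: "matroid N \<Longrightarrow> circuit N C \<Longrightarrow> finite C"
  using circuit_subset_ground matroid_finite_ground finite_subset by metis

lemma circuit_nonempty: "matroid N \<Longrightarrow> circuit N C \<Longrightarrow> C \<noteq> {}"
  unfolding circuit_def using matroid_empty_indep by metis

lemma circuit_Min_in: "matroid N \<Longrightarrow> circuit N C \<Longrightarrow> Min C \<in> C"
  using circuit_finite circuit_nonempty Min_in by metis

lemma circuit_Min_le: "matroid N \<Longrightarrow> circuit N C \<Longrightarrow> c \<in> C \<Longrightarrow> Min C \<le> c"
  using circuit_finite Min_le by metis

lemma circuit_not_subset_indep: "matroid N \<Longrightarrow> circuit N C \<Longrightarrow> I \<in> indeps N \<Longrightarrow> \<not> C \<subseteq> I"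
  unfolding circuit_def using matroid_indep_subset by metis

lemma dependent_contains_circuit:
  assumes "matroid N" "S \<subseteq> ground N" "S \<notin> indeps N"
  obtains C where "circuit N C" "C \<subseteq> S"
proof -
  let ?F = "{C. C \<subseteq> S \<and> C \<notin> indeps N}"
  have "finite ?F"
    using assms matroid_finite_ground finite_subset
    by (intro finite_subset[of ?F "Pow S"]) auto
  moreover have "S \<in> ?F"
    using assms by simp
  ultimately have "\<exists>C\<in>?F. C \<subseteq> S \<and> (\<forall>D\<in>?F. D \<subseteq> C \<longrightarrow> C = D)"
    by (rule finite_has_minimal2)
  then obtain C where "C \<in> ?F" and min: "\<forall>D\<in>?F. D \<subseteq> C \<longrightarrow> C = D"
    by blast
  have "circuit N C"
    unfolding circuit_def
  proof (intro conjI allI impI)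
    fix D assume "D \<subset> C"
    then show "D \<in> indeps N"
      using bspec[OF min, of D] \<open>C \<in> ?F\<close> by blast
  qed (use \<open>C \<in> ?F\<close> assms(2) in blast)+
  with \<open>C \<in> ?F\<close> show thesis
    using that by blast
qed

lemma circuit_through_new_element:
  assumes "matroid N" "I \<in> indeps N" "e \<in> ground N" "insert e I \<notin> indeps N"
  obtains C where "circuit N C" "C \<subseteq> insert e I" "e \<in> C"
proof -
  obtain C where "circuit N C" "C \<subseteq> insert e I"
    using dependent_contains_circuit[OF assms(1), of "insert e I"] assms(3,4)
      matroid_indep_subset_ground[OF assms(1,2)] by (metis insert_subset)
  moreover from this have "e \<in> C"
    using circuit_not_subset_indep[OF assms(1) _ assms(2)] by blast
  ultimately show thesis by (rule that)
qed

text \<open>A basis avoiding \<open>D - {e}\<close> is exchanged for one containing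
  \<open>C - {e}\<close>. The new basis misses \<open>e\<close>, as it cannot contain
  \<open>C\<close>, and so it misses all of \<open>D\<close>, which would make \<open>D\<close>
  independent in the dual.\<close>

lemma circuit_cocircuit_orthogonal:
  assumes N: "matroid N" and C: "circuit N C" and D: "circuit (dual N) D"
  shows "C \<inter> D \<noteq> {e}"
proof
  assume e: "C \<inter> D = {e}"
  then have "C - {e} \<in> indeps N" "D - {e} \<in> indeps (dual N)"
    using circuit_psubset_indep[OF C, of "C - {e}"] circuit_psubset_indep[OF D, of "D - {e}"]
    by blast+
  then obtain B where B: "basis N B" "(D - {e}) \<inter> B = {}"
    using dual_indepE by metis
  obtain B' where B': "basis N B'" "C - {e} \<subseteq> B'" "B' \<subseteq> (C - {e}) \<union> B"
    using extend_to_basis[OF N \<open>C - {e} \<in> indeps N\<close> B(1)] by blast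
  have "e \<notin> B'"
    using B'(2) circuit_not_subset_indep[OF N C basis_indep[OF B'(1)]] by blast
  then have "D \<inter> B' = {}"
    using B'(3) B(2) e by blast
  then have "D \<in> indeps (dual N)"
    using dual_indepI[OF B'(1)] circuit_subset_ground[OF D] by simp
  then show False
    using circuit_dependent[OF D] by blast
qed

text \<open>Minty's painting lemma: \<open>R\<close> is one colour, the rest of the ground set apart
  from \<open>e\<close> the other. The cocircuit is a fundamental one, for a basis that extends
  \<open>e\<close> and a maximal independent subset \<open>I\<close> of \<open>R\<close>.\<close>

lemma painting:
  assumes N: "matroid N" and e: "e \<in> ground N" and R: "e \<notin> R" "R \<subseteq> ground N"
    and no_circuit: "\<nexists>C. circuit N C \<and> e \<in> C \<and> C \<subseteq> insert e R"
  obtains D where "circuit (dual N) D" "e \<in> D" "D \<inter> R = {}"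
proof -
  obtain I where I: "I \<in> indeps N" "I \<subseteq> R"
    and max: "\<And>r. r \<in> R \<Longrightarrow> insert r I \<in> indeps N \<Longrightarrow> r \<in> I"
    using maximal_indep_between[OF N matroid_empty_indep[OF N], of R] by auto
  have "insert e I \<in> indeps N"
  proof (rule ccontr)
    assume "insert e I \<notin> indeps N"
    then obtain C where "circuit N C" "C \<subseteq> insert e I" "e \<in> C"
      using circuit_through_new_element[OF N I(1) e] by blast
    then show False
      using no_circuit I(2) by blast
  qed
  then obtain B where B: "basis N B" "insert e I \<subseteq> B"
    using basis_exists[OF N] extend_to_basis[OF N] by metis
  \<comment> \<open>The circuit of the dual inside this set is the fundamental cocircuit of
    \<open>e\<close> with respect to \<open>B\<close>.\<close>
  let ?S = "insert e (ground N - B)"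
  have "?S \<notin> indeps (dual N)"
  proof
    assume "?S \<in> indeps (dual N)"
    then obtain A where A: "basis N A" "?S \<inter> A = {}"
      using dual_indepE by metis
    then have "A \<subseteq> B" "e \<notin> A"
      using basis_subset_ground[OF N A(1)] by blast+
    then show False
      using basis_maximal[OF A(1) basis_indep[OF B(1)]] B(2) by blast
  qed
  moreover have "ground N - B \<in> indeps (dual N)"
    by (rule dual_indepI[OF B(1)]) auto
  ultimately obtain D where D: "circuit (dual N) D" "D \<subseteq> ?S" "e \<in> D"
    using circuit_through_new_element[OF matroid_dual[OF N]] e by (metis ground_dual)
  have "r \<notin> D" if "r \<in> R" for r
  proof
    assume "r \<in> D"
    then have "r \<notin> B"
      using D(2) R(1) \<open>r \<in> R\<close> by blast
    then have "insert r I \<notin> indeps N"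
      using max[OF \<open>r \<in> R\<close>] B(2) by blast
    then obtain C where C: "circuit N C" "C \<subseteq> insert r I" "r \<in> C"
      using circuit_through_new_element[OF N I(1)] R(2) \<open>r \<in> R\<close> by blast
    \<comment> \<open>Apart from \<open>r\<close>, the circuit lies in \<open>I\<close>, hence in
      \<open>B\<close>; the only element of \<open>B\<close> that \<open>D\<close> may contain is
      \<open>e\<close>, which is not in \<open>R\<close>.\<close>
    then have "C \<inter> D = {r}"
      using D(2) B(2) I(2) R(1) \<open>r \<in> D\<close> \<open>r \<in> R\<close> by blast
    then show False
      using circuit_cocircuit_orthogonal[OF N C(1) D(1)] by blast
  qed
  then show thesis
    using that D by blast
qed

lemma circuit_restrict:
  "X \<subseteq> ground N \<Longrightarrow> circuit (restrict N X) C \<longleftrightarrow> circuit N C \<and> C \<subseteq> X"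
  unfolding circuit_def restrict_def by auto

section \<open>Minimal bases\<close>

text \<open>By \<open>B_min_dual_restrict\<close> this is the minimal basis of the dual of the
  restriction to \<open>X\<close>, in a form to which orthogonality applies directly.\<close>

definition circuit_mins :: "('a::linorder) pre_matroid \<Rightarrow> 'a set \<Rightarrow> 'a set" where
  "circuit_mins N X = {e. \<exists>C. circuit N C \<and> C \<subseteq> X \<and> Min C = e}"

lemma circuit_mins_subset: "matroid N \<Longrightarrow> circuit_mins N X \<subseteq> X"
  unfolding circuit_mins_def using circuit_Min_in by blast

text \<open>Both enumerations start with the elements below \<open>e\<close>; then one continues
  with \<open>e\<close>, the other with something larger. The element \<open>b\<close> ensures that
  the second does not stop there, since a proper prefix would come first.\<close>

lemma lex_lessI:
  fixes A B :: "'a::linorder set"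
  assumes fin: "finite A" "finite B" and e: "e \<in> A" "e \<notin> B"
    and below: "\<And>x. x < e \<Longrightarrow> x \<in> A \<longleftrightarrow> x \<in> B" and b: "b \<in> B" "e < b"
  shows "lex_less A B"
proof -
  let ?l = "sorted_list_of_set (A \<inter> {..<e})"
    and ?a = "sorted_list_of_set (A \<inter> {e<..})" and ?b = "sorted_list_of_set (B \<inter> {e<..})"
  have A: "sorted_list_of_set A = ?l @ e # ?a"
    by (rule sorted_distinct_set_unique) (use fin e in \<open>auto simp: sorted_append\<close>)
  have eq: "A \<inter> {..<e} = B \<inter> {..<e}"
    using below by auto
  have "sorted_list_of_set B = ?l @ ?b"
    unfolding eq
    by (rule sorted_distinct_set_unique) (use fin e in \<open>auto simp: sorted_append not_less le_less\<close>)
  moreover obtain y ys where y: "?b = y # ys"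
    using b fin by (cases ?b) auto
  then have "e < y"
    using fin by (metis Int_iff finite_Int greaterThan_iff list.set_intros(1) set_sorted_list_of_set)
  ultimately show ?thesis
    unfolding lex_less_def A using y by (auto intro: lexord_append_leftI)
qed

lemma lex_less_asym: "lex_less A B \<Longrightarrow> \<not> lex_less B A"
  unfolding lex_less_def by (rule lexord_asymmetric) (auto intro: asymI)

lemma B_min_eqI:
  assumes "basis N B" "\<And>B'. basis N B' \<Longrightarrow> B' \<noteq> B \<Longrightarrow> lex_less B B'"
  shows "B_min N = B"
  unfolding B_min_def by (rule the_equality) (use assms lex_less_asym in blast)+

text \<open>Independence holds because every circuit contains its own minimum. If the set were not
  maximal, painting would give a cocircuit made up of circuit minima only.\<close>

lemma basis_complement_circuit_mins:
  assumes K: "matroid K"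
  shows "basis K (ground K - circuit_mins K (ground K))"
proof -
  let ?P = "circuit_mins K (ground K)" and ?S = "ground K - circuit_mins K (ground K)"
  have indep: "?S \<in> indeps K"
  proof (rule ccontr)
    assume "?S \<notin> indeps K"
    then obtain C where "circuit K C" "C \<subseteq> ?S"
      using dependent_contains_circuit[OF K] by blast
    then show False
      using circuit_Min_in[OF K] circuit_subset_ground unfolding circuit_mins_def by blast
  qed
  have "I = ?S" if I: "I \<in> indeps K" "?S \<subseteq> I" for I
  proof (rule ccontr)
    assume "I \<noteq> ?S"
    then obtain e where e: "e \<in> I" "e \<notin> ?S" "e \<in> ground K"
      using I matroid_indep_subset_ground[OF K] by blast
    have "\<nexists>C. circuit K C \<and> e \<in> C \<and> C \<subseteq> insert e ?S"
      using circuit_not_subset_indep[OF K _ I(1)] e(1) I(2) by blast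
    then obtain D where D: "circuit (dual K) D" "D \<inter> ?S = {}"
      using painting[OF K e(3,2)] by blast
    \<comment> \<open>A circuit with minimum \<open>d\<close> lies above \<open>d\<close> and the
      cocircuit \<open>D\<close> below it, so they meet in \<open>d\<close> alone.\<close>
    define d where "d = Max D"
    have fin: "finite D" "D \<noteq> {}"
      using D(1) circuit_finite circuit_nonempty matroid_dual[OF K] by metis+
    then have d: "d \<in> D" "\<And>x. x \<in> D \<Longrightarrow> x \<le> d"
      by (auto simp: d_def)
    then have "d \<in> ?P"
      using D(2) circuit_subset_ground[OF D(1)] by auto
    then obtain C where C: "circuit K C" "Min C = d"
      unfolding circuit_mins_def by blast
    then have "C \<inter> D = {d}"
      using d circuit_Min_in[OF K C(1)] circuit_Min_le[OF K C(1)] by force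
    then show False
      using circuit_cocircuit_orthogonal[OF K C(1) D(1)] by blast
  qed
  with indep show ?thesis
    unfolding basis_def by blast
qed

text \<open>Any other basis \<open>B\<close> of the dual is compared with the set of minima at
  \<open>e\<close>, the least element in which they differ.\<close>

lemma B_min_dual:
  assumes K: "matroid K"
  shows "B_min (dual K) = circuit_mins K (ground K)"
proof (rule B_min_eqI)
  let ?P = "circuit_mins K (ground K)"
  have Pg: "?P \<subseteq> ground K"
    using circuit_mins_subset[OF K] .
  then have "ground K - (ground K - ?P) = ?P" by blast
  then show P: "basis (dual K) ?P"
    using dual_basisI[OF K basis_complement_circuit_mins[OF K]] by simp
  fix B assume B: "basis (dual K) B" "B \<noteq> ?P"
  let ?T = "ground K - B"
  have T: "basis K ?T"
    using dual_basis_complement[OF K B(1)] .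
  have Bg: "B \<subseteq> ground K"
    using dual_indepE[OF basis_indep[OF B(1)]] by metis
  have fin: "finite ?P" "finite B"
    using Pg Bg matroid_finite_ground[OF K] finite_subset by metis+
  have card: "card ?P = card B"
    using card_bases_eq[OF matroid_dual[OF K] P B(1)] .
  define e where "e = Min ((?P - B) \<union> (B - ?P))"
  have "(?P - B) \<union> (B - ?P) \<noteq> {}"
    using B(2) by blast
  then have e: "e \<in> (?P - B) \<union> (B - ?P)"
    using fin Min_in unfolding e_def by (metis finite_Diff finite_UnI)
  have below: "x \<in> ?P \<longleftrightarrow> x \<in> B" if "x < e" for x
  proof -
    have "x \<notin> (?P - B) \<union> (B - ?P)"
      using that fin Min_le[of "(?P - B) \<union> (B - ?P)" x] unfolding e_def
      by (metis finite_Diff finite_UnI not_le)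
    then show ?thesis by blast
  qed
  \<comment> \<open>Otherwise the fundamental circuit of \<open>e\<close> over the complement of
    \<open>B\<close> has its minimum below \<open>e\<close>, where the two sets agree. That minimum
    would lie in \<open>B\<close>, which the circuit meets only in \<open>e\<close>.\<close>
  have "e \<in> ?P"
  proof (rule ccontr)
    assume "e \<notin> ?P"
    with e have "e \<in> B" by blast
    then have "insert e ?T \<notin> indeps K"
      using basis_maximal[OF T, of "insert e ?T"] by blast
    then obtain C where C: "circuit K C" "C \<subseteq> insert e ?T" "e \<in> C"
      using circuit_through_new_element[OF K basis_indep[OF T]] Bg \<open>e \<in> B\<close> by blast
    then have "Min C \<in> ?P"
      unfolding circuit_mins_def using circuit_subset_ground by blast
    moreover from this have "Min C \<noteq> e"
      using \<open>e \<notin> ?P\<close> by metis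
    then have "Min C < e"
      using circuit_Min_le[OF K C(1,3)] by simp
    ultimately have "Min C \<in> B"
      using below by blast
    then show False
      using circuit_Min_in[OF K C(1)] C(2) \<open>Min C \<noteq> e\<close> by blast
  qed
  with e have "e \<notin> B" by blast
  \<comment> \<open>Without such an element, \<open>B\<close> would be contained in the set of
    minima, and equal cardinality would make them equal.\<close>
  have "\<exists>b\<in>B. e < b"
  proof (rule ccontr)
    assume "\<not> ?thesis"
    then have "B \<subseteq> ?P"
      using below \<open>e \<notin> B\<close> by (metis linorder_neqE subsetI)
    then show False
      using card_subset_eq[OF fin(1)] card B(2) by metis
  qed
  then show "lex_less ?P B"
    using lex_lessI[OF fin \<open>e \<in> ?P\<close> \<open>e \<notin> B\<close> below] by blast
qed

lemma B_min_dual_restrict: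
  assumes "matroid N" "X \<subseteq> ground N"
  shows "B_min (dual (restrict N X)) = circuit_mins N X"
proof -
  have "ground (restrict N X) = X"
    by (simp add: restrict_def)
  then show ?thesis
    using B_min_dual[OF matroid_restrict[OF assms]]
    by (simp add: circuit_mins_def circuit_restrict[OF assms(2)])
qed

lemma ext_actE:
  assumes "e \<in> ext_act K S" "matroid K"
  obtains C where "circuit K C" "C \<subseteq> insert e S" "e \<in> C" "\<And>c. c \<in> C \<Longrightarrow> e \<le> c" "e \<notin> S"
  using assms circuit_Min_in[OF assms(2)] circuit_Min_le[OF assms(2)] unfolding ext_act_def
  by blast

lemma circuit_minsE:
  assumes "e \<in> circuit_mins K S" "matroid K"
  obtains C where "circuit K C" "C \<subseteq> S" "e \<in> C" "\<And>c. c \<in> C \<Longrightarrow> e \<le> c" "Min C = e"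
  using assms circuit_Min_in[OF assms(2)] circuit_Min_le[OF assms(2)] unfolding circuit_mins_def
  by blast

section \<open>Orthogonal pairs of matroids\<close>

locale orthogonal_pair =
  fixes M N :: "('a::linorder) pre_matroid" and E :: "'a set"
  assumes M: "matroid M" and N: "matroid N"
    and ground_M: "ground M = E" and ground_N: "ground N = E"
    and orthogonal: "circuit M C \<Longrightarrow> circuit N D \<Longrightarrow> C \<inter> D \<noteq> {e}"
begin

text \<open>Through this lemma each result of the locale yields its dual; \<open>F_swap\<close> and
  \<open>G_swap\<close> translate the maps.\<close>

lemma swap: "orthogonal_pair N M E"
proof
  show "C \<inter> D \<noteq> {e}" if "circuit N C" "circuit M D" for C D e
    using orthogonal[OF that(2,1)] by (simp add: Int_commute)
qed (fact M N ground_M ground_N)+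

text \<open>When \<open>N\<close> is the dual of \<open>M'\<close>, the removed part is the set of
  internally active elements of \<open>B\<close> in \<open>M'\<close>.\<close>

definition F :: "'a set \<Rightarrow> 'a set" where
  "F B = (B - ext_act N (E - B)) \<union> ext_act M B"

text \<open>The two sets of minima are the minimal bases in the formula for \<open>g\<close>, again
  for \<open>N\<close> the dual of \<open>M'\<close>.\<close>

definition G :: "'a set \<Rightarrow> 'a set" where
  "G X = (X - circuit_mins M X) \<union> circuit_mins N (E - X)"

lemma F_subset: "B \<subseteq> E \<Longrightarrow> F B \<subseteq> E"
  unfolding F_def ext_act_def ground_M by blast

lemma G_subset: "X \<subseteq> E \<Longrightarrow> G X \<subseteq> E"
  unfolding G_def using circuit_mins_subset[OF N, of "E - X"] by blast

lemma F_swap: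
  assumes "B \<subseteq> E"
  shows "orthogonal_pair.F N M E (E - B) = E - F B"
proof -
  have "E - (E - B) = B"
    using assms by blast
  then show ?thesis
    unfolding orthogonal_pair.F_def[OF swap] F_def
    using assms by (auto simp: ext_act_def ground_M ground_N)
qed

lemma G_swap:
  assumes "X \<subseteq> E"
  shows "orthogonal_pair.G N M E (E - X) = E - G X"
proof -
  have "E - (E - X) = X"
    using assms by blast
  then show ?thesis
    unfolding orthogonal_pair.G_def[OF swap] G_def
    using assms circuit_mins_subset[OF M, of X] circuit_mins_subset[OF N, of "E - X"] by auto
qed

section \<open>Orthogonality and activities\<close>

lemma common_other_element:
  assumes "circuit M C" "circuit N D" "e \<in> C" "e \<in> D"
  obtains c where "c \<in> C" "c \<in> D" "c \<noteq> e"
  using orthogonal[OF assms(1,2), of e] assms(3,4) by blast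

lemma cocircuit_common_other_element:
  assumes "circuit M C" "circuit (dual M) D" "e \<in> C" "e \<in> D"
  obtains c where "c \<in> C" "c \<in> D" "c \<noteq> e"
  using circuit_cocircuit_orthogonal[OF M assms(1,2), of e] assms(3,4) by blast

lemma ext_actI:
  assumes "e \<in> E" "e \<notin> S" "circuit M C" "C \<subseteq> insert e S" "e \<in> C" "\<And>c. c \<in> C \<Longrightarrow> e \<le> c"
  shows "e \<in> ext_act M S"
proof -
  have "Min C = e"
    using assms(5,6) circuit_finite[OF M assms(3)] by (intro Min_eqI) auto
  then show ?thesis
    using assms unfolding ext_act_def ground_M by blast
qed

text \<open>Painting with the part of \<open>S\<close> above \<open>e\<close> as the colour class: a
  circuit through \<open>e\<close> in that class would have minimum \<open>e\<close> and make
  \<open>e\<close> active.\<close>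

lemma not_ext_act_cocircuit:
  assumes "e \<in> E" "e \<notin> S" "S \<subseteq> E" "e \<notin> ext_act M S"
  obtains D where "circuit (dual M) D" "e \<in> D" "\<And>x. x \<in> S \<Longrightarrow> e < x \<Longrightarrow> x \<notin> D"
proof -
  let ?R = "{x \<in> S. e < x}"
  have "\<nexists>C. circuit M C \<and> e \<in> C \<and> C \<subseteq> insert e ?R"
  proof
    assume "\<exists>C. circuit M C \<and> e \<in> C \<and> C \<subseteq> insert e ?R"
    then obtain C where C: "circuit M C" "e \<in> C" "C \<subseteq> insert e ?R" by blast
    have "e \<in> ext_act M S"
      by (rule ext_actI[OF assms(1,2) C(1) _ C(2)]) (use C(3) in auto)
    then show False
      using assms(4) by blast
  qed
  then obtain D where "circuit (dual M) D" "e \<in> D" "D \<inter> ?R = {}"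
    using painting[OF M, of e ?R] assms(1,3) ground_M by blast
  then show thesis
    using that by blast
qed

section \<open>The images of the two maps\<close>

lemma G_indep:
  assumes X: "X \<subseteq> E"
  shows "G X \<in> indeps M"
proof (rule ccontr)
  assume "G X \<notin> indeps M"
  then obtain C where C: "circuit M C" "C \<subseteq> G X"
    using dependent_contains_circuit[OF M] G_subset[OF X] ground_M by blast
  show False
  proof (cases "C \<subseteq> X")
    case True
    \<comment> \<open>\<open>G\<close> removes this minimum, and what it adds lies outside
      \<open>X\<close>.\<close>
    then have "Min C \<in> circuit_mins M X"
      unfolding circuit_mins_def using C(1) by blast
    then show False
      using C(2) True circuit_Min_in[OF M C(1)] circuit_mins_subset[OF N, of "E - X"]
      unfolding G_def by blast
  next
    case False
    \<comment> \<open>As an element added by \<open>G\<close>, \<open>e\<close> is the minimum of a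
      circuit of \<open>N\<close> outside \<open>X\<close>. A second common element with
      \<open>C\<close> would be above \<open>e\<close> by this, and at most \<open>e\<close> by
      maximality.\<close>
    define e where "e = Max (C - X)"
    have fin: "finite (C - X)" "C - X \<noteq> {}"
      using circuit_finite[OF M C(1)] False by auto
    have e: "e \<in> C - X"
      unfolding e_def using fin by (rule Max_in)
    then have "e \<in> circuit_mins N (E - X)"
      using C(2) unfolding G_def by blast
    then obtain D where D: "circuit N D" "D \<subseteq> E - X" "e \<in> D" "\<And>c. c \<in> D \<Longrightarrow> e \<le> c"
      using circuit_minsE[OF _ N] by metis
    obtain c where c: "c \<in> C" "c \<in> D" "c \<noteq> e"
      using common_other_element[OF C(1) D(1) _ D(3)] e by blast
    then have "c \<le> e"
      unfolding e_def using D(2) fin(1) by (intro Max_ge) auto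
    then show False
      using c D(4) by force
  qed
qed

text \<open>Circuits witnessing external activity thus survive the removal made by \<open>F\<close>.
  A removed element \<open>i\<close> of \<open>C\<close> would have a circuit of \<open>N\<close>
  meeting \<open>C\<close> at most in \<open>i\<close> and \<open>e\<close>; meeting in both would
  force each to be at most the other.\<close>

lemma circuit_disjoint_ext_act:
  assumes B: "B \<subseteq> E" and e: "e \<notin> B"
    and C: "circuit M C" "C \<subseteq> insert e B" "\<And>c. c \<in> C \<Longrightarrow> e \<le> c"
  shows "C \<inter> ext_act N (E - B) = {}"
proof (rule ccontr)
  assume "C \<inter> ext_act N (E - B) \<noteq> {}"
  then obtain i where i: "i \<in> C" "i \<in> ext_act N (E - B)" by blast
  then obtain D where D: "circuit N D" "D \<subseteq> insert i (E - B)" "i \<in> D"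
      "\<And>d. d \<in> D \<Longrightarrow> i \<le> d" "i \<notin> E - B"
    using ext_actE[OF _ N] by metis
  obtain c where c: "c \<in> C" "c \<in> D" "c \<noteq> i"
    using common_other_element[OF C(1) D(1) i(1) D(3)] .
  then have "c = e"
    using C(2) D(2) by blast
  then show False
    using c C(3)[OF i(1)] D(4) by force
qed

text \<open>Let \<open>m\<close> be the minimum of a violating circuit \<open>C\<close>. All other
  elements of \<open>C\<close> outside \<open>B\<close> are externally active, and the circuit
  witnessing this for one of them is played against a circuit of \<open>N\<close> or a cocircuit of
  \<open>M\<close> through \<open>m\<close>.\<close>

lemma F_compatible:
  assumes B: "B \<subseteq> E"
  shows "compatible M (E - F B)"
  unfolding compatible_def ground_M
proof (intro conjI notI)
  show "E - F B \<subseteq> E" by blast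
  assume "\<exists>C. circuit M C \<and> (E - F B) \<inter> C = {Min C}"
  then obtain C where C: "circuit M C" "(E - F B) \<inter> C = {Min C}" by blast
  define m where "m = Min C"
  have mC: "m \<in> C" "m \<in> E" "m \<notin> F B"
    using C(2) unfolding m_def by auto
  have above: "c \<in> F B" "m < c" if "c \<in> C" "c \<noteq> m" for c
    using C(2) that circuit_Min_le[OF M C(1), of c] circuit_subset_ground[OF C(1)]
    unfolding m_def ground_M by auto
  have ext: "c \<in> ext_act M B" if "c \<in> C" "c \<noteq> m" "c \<notin> B" for c
    using above(1)[OF that(1,2)] that(3) unfolding F_def by blast
  show False
  proof (cases "m \<in> B")
    case True
    \<comment> \<open>Within \<open>B\<close>, the witness \<open>D\<close> contains only
      \<open>m\<close>. The active element \<open>c\<close> shared with \<open>C\<close> has a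
      circuit \<open>C'\<close> lying above \<open>c\<close>, hence above \<open>m\<close>, so
      \<open>C'\<close> and \<open>D\<close> share \<open>c\<close> alone.\<close>
    then have "m \<in> ext_act N (E - B)"
      using mC(3) unfolding F_def by blast
    then obtain D where D: "circuit N D" "D \<subseteq> insert m (E - B)" "m \<in> D"
      using ext_actE[OF _ N] by metis
    obtain c where c: "c \<in> C" "c \<in> D" "c \<noteq> m"
      using common_other_element[OF C(1) D(1) mC(1) D(3)] .
    then have "c \<in> ext_act M B"
      using ext D(2) by blast
    then obtain C' where C': "circuit M C'" "C' \<subseteq> insert c B" "c \<in> C'"
        "\<And>x. x \<in> C' \<Longrightarrow> c \<le> x"
      using ext_actE[OF _ M] by metis
    obtain x where "x \<in> C'" "x \<in> D" "x \<noteq> c"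
      using common_other_element[OF C'(1) D(1) C'(3) c(2)] .
    then show False
      using C'(2) D(2) C'(4)[of m] above(2)[OF c(1,3)] by auto
  next
    case False
    \<comment> \<open>Here \<open>D\<close> avoids the part of \<open>B\<close> above
      \<open>m\<close>, and the circuit \<open>C'\<close> of the shared active element has all its
      other elements there.\<close>
    then have "m \<notin> ext_act M B"
      using mC(3) unfolding F_def by blast
    then obtain D where D: "circuit (dual M) D" "m \<in> D"
      "\<And>x. x \<in> B \<Longrightarrow> m < x \<Longrightarrow> x \<notin> D"
      using not_ext_act_cocircuit[OF mC(2) False B] by metis
    obtain c where c: "c \<in> C" "c \<in> D" "c \<noteq> m"
      using cocircuit_common_other_element[OF C(1) D(1) mC(1) D(2)] .
    then have "c \<in> ext_act M B"
      using ext D(3) above(2) by blast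
    then obtain C' where C': "circuit M C'" "C' \<subseteq> insert c B" "c \<in> C'"
        "\<And>x. x \<in> C' \<Longrightarrow> c \<le> x"
      using ext_actE[OF _ M] by metis
    obtain x where x: "x \<in> C'" "x \<in> D" "x \<noteq> c"
      using cocircuit_common_other_element[OF C'(1) D(1) C'(3) c(2)] .
    then have "x \<in> B" "m < x"
      using C'(2) C'(4)[of x] above(2)[OF c(1,3)] by auto
    then show False
      using D(3) x(2) by blast
  qed
qed

section \<open>What one map adds, the other removes\<close>

lemma circuit_mins_F:
  assumes B: "B \<in> indeps M"
  shows "circuit_mins M (F B) = ext_act M B"
proof
  have BE: "B \<subseteq> E"
    using matroid_indep_subset_ground[OF M B] ground_M by simp
  show "ext_act M B \<subseteq> circuit_mins M (F B)"
  proof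
    fix e assume e: "e \<in> ext_act M B"
    then obtain C where C: "circuit M C" "C \<subseteq> insert e B" "Min C = e" and "e \<notin> B"
      unfolding ext_act_def by blast
    then have "C \<inter> ext_act N (E - B) = {}"
      using circuit_disjoint_ext_act[OF BE _ C(1,2)] circuit_Min_le[OF M C(1)] by blast
    then have "C \<subseteq> F B"
      using C(2) e unfolding F_def by blast
    then show "e \<in> circuit_mins M (F B)"
      using C unfolding circuit_mins_def by blast
  qed
  show "circuit_mins M (F B) \<subseteq> ext_act M B"
  proof
    fix e assume e: "e \<in> circuit_mins M (F B)"
    then obtain C where C: "circuit M C" "C \<subseteq> F B" "e \<in> C" "\<And>c. c \<in> C \<Longrightarrow> e \<le> c"
      using circuit_minsE[OF _ M] by metis
    have "e \<notin> B"
    proof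
      assume "e \<in> B"
      \<comment> \<open>Independence of \<open>B\<close> gives a cocircuit meeting \<open>B\<close>
        only in \<open>e\<close>. It shares with \<open>C\<close> an externally active element above
        \<open>e\<close>, whose own circuit is then too high to contain \<open>e\<close>.\<close>
      have "\<nexists>C. circuit M C \<and> e \<in> C \<and> C \<subseteq> insert e (B - {e})"
        using circuit_not_subset_indep[OF M _ B] \<open>e \<in> B\<close> by (simp add: insert_absorb)
      then obtain D where D: "circuit (dual M) D" "e \<in> D" "D \<inter> (B - {e}) = {}"
        using painting[OF M, of e "B - {e}"] \<open>e \<in> B\<close> BE ground_M by blast
      obtain c where c: "c \<in> C" "c \<in> D" "c \<noteq> e"
        using cocircuit_common_other_element[OF C(1) D(1) C(3) D(2)] .
      then have "c \<in> ext_act M B" "e < c"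
        using C(2,4) D(3) unfolding F_def by force+
      then obtain C' where C': "circuit M C'" "C' \<subseteq> insert c B" "c \<in> C'"
          "\<And>x. x \<in> C' \<Longrightarrow> c \<le> x"
        using ext_actE[OF _ M] by metis
      obtain x where "x \<in> C'" "x \<in> D" "x \<noteq> c"
        using cocircuit_common_other_element[OF C'(1) D(1) C'(3) c(2)] .
      then show False
        using C'(2) C'(4)[of x] D(3) \<open>e < c\<close> by auto
    qed
    then show "e \<in> ext_act M B"
      using C(2,3) unfolding F_def by blast
  qed
qed

text \<open>Each inclusion takes a largest counterexample and lets orthogonality produce a larger
  one; compatibility enters in the second.\<close>

lemma ext_act_G:
  assumes X: "X \<subseteq> E" and compatible: "compatible M (E - X)"
  shows "ext_act M (G X) = circuit_mins M X"
proof
  let ?P = "circuit_mins M X" and ?J = "circuit_mins N (E - X)"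
  have sub: "?P \<subseteq> X" "?J \<subseteq> E - X"
    using circuit_mins_subset M N by blast+
  show "?P \<subseteq> ext_act M (G X)"
  proof (rule subsetI, rule ccontr)
    fix e assume e: "e \<in> ?P" "e \<notin> ext_act M (G X)"
    then have "e \<in> E" "e \<notin> G X"
      using X sub unfolding G_def by blast+
    then obtain D where D: "circuit (dual M) D" "e \<in> D"
        "\<And>x. x \<in> G X \<Longrightarrow> e < x \<Longrightarrow> x \<notin> D"
      using not_ext_act_cocircuit[OF _ _ G_subset[OF X] e(2)] by metis
    \<comment> \<open>For the largest element of \<open>A\<close>, a circuit in \<open>X\<close>
      with that minimum shares a larger \<open>x\<close> with \<open>D\<close>. As \<open>D\<close>
      avoids \<open>G X\<close> above \<open>e\<close>, \<open>x\<close> was removed by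
      \<open>G\<close> and so belongs to \<open>A\<close>.\<close>
    define A where "A = {c \<in> ?P \<inter> D. e \<le> c}"
    have "finite A" "e \<in> A"
      using circuit_finite[OF matroid_dual[OF M] D(1)] e(1) D(2) unfolding A_def by auto
    then have "Max A \<in> A" and max: "\<And>x. x \<in> A \<Longrightarrow> x \<le> Max A"
      using Max_in[of A] by (blast, simp)
    then have c: "Max A \<in> ?P" "Max A \<in> D" "e \<le> Max A"
      unfolding A_def by auto
    obtain C where C: "circuit M C" "C \<subseteq> X" "Max A \<in> C" "\<And>x. x \<in> C \<Longrightarrow> Max A \<le> x"
      using circuit_minsE[OF c(1) M] by metis
    obtain x where x: "x \<in> C" "x \<in> D" "x \<noteq> Max A"
      using cocircuit_common_other_element[OF C(1) D(1) C(3) c(2)] .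
    then have "Max A < x"
      using C(4) by force
    with c(3) have "e < x" by simp
    then have "x \<in> ?P"
      using D(3) x C(2) unfolding G_def by blast
    then have "x \<in> A"
      using x \<open>e < x\<close> unfolding A_def by simp
    then show False
      using max \<open>Max A < x\<close> by force
  qed
  show "ext_act M (G X) \<subseteq> ?P"
  proof (rule subsetI, rule ccontr)
    fix e assume e: "e \<in> ext_act M (G X)" "e \<notin> ?P"
    then obtain C where C: "circuit M C" "C \<subseteq> insert e (G X)" "Min C = e"
      and eG: "e \<notin> G X" "e \<in> E"
      unfolding ext_act_def ground_M by blast
    have eC: "e \<in> C"
      using circuit_Min_in[OF M C(1)] C(3) by simp
    have "e \<notin> X"
      using e(2) eG unfolding G_def by blast
    have "C \<inter> ?J = {}"
    proof (rule ccontr)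
      assume ne: "C \<inter> ?J \<noteq> {}"
      have fin: "finite (C \<inter> ?J)"
        using circuit_finite[OF M C(1)] by blast
      \<comment> \<open>The circuit of \<open>N\<close> with minimum \<open>j\<close> shares with
        \<open>C\<close> an element above \<open>j\<close>. It lies outside \<open>X\<close> and
        differs from \<open>e\<close>, so it was added by \<open>G\<close>, against the choice of
        \<open>j\<close>.\<close>
      define j where "j = Max (C \<inter> ?J)"
      have j: "j \<in> C" "j \<in> ?J"
        using Max_in[OF fin ne] unfolding j_def by auto
      then obtain D where D: "circuit N D" "D \<subseteq> E - X" "j \<in> D" "\<And>x. x \<in> D \<Longrightarrow> j \<le> x"
        using circuit_minsE[OF _ N] by metis
      obtain c where c: "c \<in> C" "c \<in> D" "c \<noteq> j"
        using common_other_element[OF C(1) D(1) j(1) D(3)] .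
      have "j < c"
        using D(4)[OF c(2)] c(3) by simp
      then have "c \<noteq> e"
        using circuit_Min_le[OF M C(1) j(1)] C(3) by auto
      then have "c \<in> C \<inter> ?J"
        using c C(2) D(2) unfolding G_def by blast
      then have "c \<le> j"
        unfolding j_def using fin by (rule Max_ge[rotated])
      then show False
        using \<open>j < c\<close> by simp
    qed
    then have "(E - X) \<inter> C = {Min C}"
      using C(2,3) eC eG(2) \<open>e \<notin> X\<close> unfolding G_def by blast
    then show False
      using compatible C(1) unfolding compatible_def by blast
  qed
qed

lemma G_F:
  assumes "B \<in> indeps M" "E - B \<in> indeps N"
  shows "G (F B) = B"
proof -
  have B: "B \<subseteq> E"
    using matroid_indep_subset_ground[OF M assms(1)] ground_M by simp
  \<comment> \<open>What \<open>G\<close> adds to \<open>F B\<close> is what \<open>F\<close>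
    removed: \<open>circuit_mins_F\<close> for the exchanged pair and the complement of
    \<open>B\<close>.\<close>
  have "circuit_mins N (E - F B) = ext_act N (E - B)"
    using orthogonal_pair.circuit_mins_F[OF swap assms(2)] F_swap[OF B] by simp
  moreover have "ext_act N (E - B) \<subseteq> B" "ext_act M B \<inter> B = {}"
    unfolding ext_act_def ground_N by blast+
  ultimately show ?thesis
    unfolding G_def circuit_mins_F[OF assms(1)] unfolding F_def by blast
qed

lemma F_G:
  assumes X: "X \<subseteq> E" and "compatible N X" "compatible M (E - X)"
  shows "F (G X) = X"
proof -
  have "E - (E - X) = X"
    using X by blast
  then have "ext_act N (E - G X) = circuit_mins N (E - X)"
    using orthogonal_pair.ext_act_G[OF swap, of "E - X"] assms(2) G_swap[OF X] by simp
  moreover have "circuit_mins N (E - X) \<inter> X = {}" "circuit_mins M X \<subseteq> X"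
    using circuit_mins_subset M N by blast+
  ultimately show ?thesis
    unfolding F_def ext_act_G[OF X assms(3)] unfolding G_def by blast
qed

end

section \<open>From perspectives to orthogonal pairs\<close>

lemma perspective_orthogonal_pair:
  assumes "matroid_perspective M M'"
  shows "orthogonal_pair M (dual M') (ground M)"
proof
  show "matroid M" "matroid (dual M')" "ground M = ground M" "ground (dual M') = ground M"
    using assms matroid_dual unfolding matroid_perspective_def by auto
  fix C D e assume C: "circuit M C" and D: "circuit (dual M') D"
  show "C \<inter> D \<noteq> {e}"
  proof
    assume e: "C \<inter> D = {e}"
    obtain \<C> where "\<forall>A\<in>\<C>. circuit M' A" "C = \<Union>\<C>"
      using assms C unfolding matroid_perspective_def by metis
    moreover have "e \<in> C"
      using e by blast
    \<comment> \<open>A circuit of \<open>M'\<close> through \<open>e\<close> inside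
      \<open>C\<close> meets \<open>D\<close> only in \<open>e\<close>, against orthogonality within
      \<open>M'\<close>.\<close>
    ultimately obtain A where A: "circuit M' A" "A \<subseteq> C" "e \<in> A"
      by blast
    then have "A \<inter> D = {e}"
      using e by blast
    then show False
      using circuit_cocircuit_orthogonal[OF _ A(1) D] assms unfolding matroid_perspective_def
      by simp
  qed
qed

theorem theorem9:
  fixes M M' :: "('a::linorder) pre_matroid"
  assumes "matroid_perspective M M'"
  shows "bij_betw (f_map M M') (indep_spanning M M') (D_set M M') \<and>
         bij_betw (g_map M M') (D_set M M') (indep_spanning M M') \<and>
         (\<forall>B\<in>indep_spanning M M'. g_map M M' (f_map M M' B) = B) \<and>
         (\<forall>X\<in>D_set M M'. f_map M M' (g_map M M' X) = X)"
proof -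
  define E where "E = ground M"
  have M': "matroid M'" "ground M' = E"
    using assms unfolding matroid_perspective_def E_def by auto
  interpret orthogonal_pair M "dual M'" E
    unfolding E_def by (rule perspective_orthogonal_pair[OF assms])
  have f: "f_map M M' B = F B" if "B \<subseteq> E" for B
  proof -
    have "int_act M' B = ext_act (dual M') (E - B)"
      unfolding int_act_def ext_act_def ground_N M'(2) using that by blast
    then show ?thesis
      unfolding f_map_def F_def by simp
  qed
  \<comment> \<open>A contraction of \<open>M'\<close> is by definition the dual of a restriction of
    \<open>dual M'\<close>, so both minimal bases are covered by
    \<open>B_min_dual_restrict\<close>.\<close>
  have g: "g_map M M' X = G X" if "X \<subseteq> E" for X
    unfolding g_map_def G_def contract_def M'(2)
    using B_min_dual_restrict[OF M] B_min_dual_restrict[OF N, of "E - X"] that ground_M ground_N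
    by simp
  have S: "B \<in> indep_spanning M M' \<longleftrightarrow> B \<subseteq> E \<and> B \<in> indeps M \<and> E - B \<in> indeps (dual M')" for B
    unfolding indep_spanning_def ground_M
    using spanning_iff_complement_dual_indep[OF _ M'(1)] M'(2) by auto
  have D: "X \<in> D_set M M' \<longleftrightarrow> X \<subseteq> E \<and> compatible (dual M') X \<and> compatible M (E - X)" for X
    unfolding D_set_def ground_M by simp
  have double: "E - (E - X) = X" if "X \<subseteq> E" for X
    using that by blast
  \<comment> \<open>The two compatibility conditions are \<open>F_compatible\<close> for the pair
    and for the exchanged pair at the complement.\<close>
  have maps_F: "F B \<in> D_set M M'" if "B \<subseteq> E" for B
    unfolding D using F_subset[OF that] F_compatible[OF that]
      orthogonal_pair.F_compatible[OF swap, of "E - B"] F_swap[OF that] double by auto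
  have maps_G: "G X \<in> indep_spanning M M'" if "X \<subseteq> E" for X
    unfolding S using G_subset[OF that] G_indep[OF that]
      orthogonal_pair.G_indep[OF swap, of "E - X"] G_swap[OF that] by auto
  have fS: "f_map M M' B \<in> D_set M M'" if "B \<in> indep_spanning M M'" for B
    using that maps_F f unfolding S by simp
  have gD: "g_map M M' X \<in> indep_spanning M M'" if "X \<in> D_set M M'" for X
    using that maps_G g unfolding D by simp
  have gf: "g_map M M' (f_map M M' B) = B" if "B \<in> indep_spanning M M'" for B
    using that G_F f g F_subset unfolding S by simp
  have fg: "f_map M M' (g_map M M' X) = X" if "X \<in> D_set M M'" for X
    using that F_G f g G_subset unfolding D by simp
  have "bij_betw (f_map M M') (indep_spanning M M') (D_set M M')"
    by (rule bij_betw_byWitness[where f' = "g_map M M'"]) (use fS gD gf fg in auto)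
  moreover have "bij_betw (g_map M M') (D_set M M') (indep_spanning M M')"
    by (rule bij_betw_byWitness[where f' = "f_map M M'"]) (use fS gD gf fg in auto)
  ultimately show ?thesis
    using gf fg by blast
qed

end
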